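(* Consider the system $\dot x=f(t,x)$ on $\Omega$ with Jacobian $J(t,x)=\frac{\partial f}{\partial x}(t,x)$. Let $\ell\in\{1,\dots,n\}$, and let $p:\mathbb{R}^n\to\mathbb{R}^\ell$ and $g:\mathbb{R}_+\times\mathbb{R}^\ell\times\mathbb{R}^n\to\mathbb{R}^n$ satisfy $g(t,p(x),x)=f(t,x)$. Consider the auxiliary system $$\dot\xi=f_\xi(t,\xi,x):=\frac{\partial p(x)}{\partial x}\,g(t,\xi,x)$$ with state space $\Omega_\xi\subseteq\mathbb{R}^\ell$, and let $J_\xi(t,\xi,x):=\frac{\partial f_\xi}{\partial\xi}(t,\xi,x)$. Suppose that there exist $\lambda>0$ and a Finsler-Lyapunov function $V_\xi:T\Omega_\xi\to\mathbb{R}_+$ for the auxiliary system such that $$\frac{\partial V_\xi(\xi,\delta\xi)}{\partial\xi}f_\xi(t,\xi,x)+\frac{\partial V_\xi(\xi,\delta\xi)}{\partial\delta\xi}J_\xi(t,\xi,x)\,\delta\xi\le-\lambda V_\xi(\xi,\delta\xi)$$ for all $t\in\mathbb{R}_+$, $x\in\Omega$ and $(\xi,\delta\xi)\in T\Omega_\xi$ (that is, the system $\dot x=f(t,x)$ is partially contractive w.r.t. $p(x)$). Consider a horizontal distribution $\mathcal{H}_x=\operatorname{span}\{h^1(x),\dots,h^\ell(x)\}$ with associated matrix $H(x)=[h^1(x)\ \cdots\ h^\ell(x)]\in\mathbb{R}^{n\times\ell}$. Assume that there exist a vector norm $|\cdot|$ on $\mathbb{R}^\ell$ and $d_6,d_7>0$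 such that $$d_6|y|\le|H^T(x)H(x)y|\le d_7|y|\quad\text{for all }x\in\Omega,\ y\in\mathbb{R}^\ell.$$ Furthermore, assume that for all $t\in\mathbb{R}_+$ and all $x\in\Omega$ $$H_f^T(t,x)+H^T(x)J(t,x)=J_\xi(t,p(x),x)\,H^T(x),$$ where $$H_f(t,x):=\left[\frac{\partial h^1(x)}{\partial x}f(t,x)\ \cdots\ \frac{\partial h^\ell(x)}{\partial x}f(t,x)\right]\in\mathbb{R}^{n\times\ell}$$ is the directional derivative of $H(x)$ along $f(t,x)$. Then the system $\dot x=f(t,x)$ is also horizontally contractive w.r.t. $\mathcal{H}_x$.
   Context: **System.** $f:\mathbb{R}_+\times\mathbb{R}^n\to\mathbb{R}^n$ is continuously differentiable w.r.t. its second argument. Solutions of $\dot x=f(t,x)$ evolve on a closed and connected $n$-dimensional manifold $\Omega\subseteq\mathbb{R}^n$ with tangent bundle $T\Omega=\bigcup_{x\in\Omega}\{x\}\times T_x\Omega$. For every $a\in\Omega$ there is a unique solution $x(t,a)$ with $x(0,a)=a$, and $x(t,a)\in\Omega$ for all $t\ge0$. The variational system along $x(t,a)$ is $\delta\dot x(t,a)=J(t,x(t,a))\,\delta x(t,a)$, with solution $\delta x(t,a)=\frac{\partial x(t,a)}{\partial a}\delta a$, $\delta a\in T_a\Omega$. **Horizontal/vertical distributions.** For every $x\in\Omega$, $T_x\Omega$ is the orthogonal direct sum of $\mathcal{H}_x=\operatorname{span}\{h^1(x),\dots,h^\ell(x)\}$ and $\mathcal{Q}_x=\operatorname{span}\{q^1(x),\dots,q^{n-\ell}(x)\}$,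 where $h^i,q^i:\mathbb{R}^n\to\mathbb{R}^n$ are $C^1$. Put $H(x)=[h^1(x)\ \cdots\ h^\ell(x)]$ and $Q(x)=[q^1(x)\ \cdots\ q^{n-\ell}(x)]$, so $H^T(x)Q(x)=0$. Every $\delta x\in T_x\Omega$ is uniquely $\delta x=H(x)\delta x_h+Q(x)\delta x_q$ with $\delta x_h\in\mathbb{R}^\ell$, $\delta x_q\in\mathbb{R}^{n-\ell}$. It is assumed throughout that $H(x)$ and $Q(x)$ are bounded on $\Omega$. **Horizontal contraction.** The system $\dot x=f(t,x)$ is horizontally contractive w.r.t. $\mathcal{H}_x$ if there exist $c\ge1$, $\eta>0$ and a vector norm $|\cdot|$ such that, for every $a\in\Omega$, every solution $\delta x(t,a)=H(x(t,a))\delta x_h(t,a)+Q(x(t,a))\delta x_q(t,a)$ of the variational system satisfies $|\delta x_h(t,a)|\le ce^{-\eta t}|\delta x_h(0,a)|$ for all $t\ge0$. **Partial contraction.** The system $\dot x=f(t,x)$ is partially contractive w.r.t. $p(x)$ if $\dot\xi=f_\xi(t,\xi,x)$ is contractive w.r.t. $\xi$ for all $t\in\mathbb{R}_+$, $x\in\Omega$, $\xi\in\Omega_\xi$; i.e. the variational system $\delta\dot\xi=J_\xi(t,\xi(t),x(t))\delta\xi$ along solutions is uniformly exponentially stable. Here $p$ and $g$ are smooth enough for the derivatives involved to exist, $\Omega_\xi$ is an $\ell$-dimensional state space in $\mathbb{R}^\ell$ (so $T_\xi\Omega_\xi=\mathbb{R}^\ell$) and $p(x)\in\Omega_\xi$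 for $x\in\Omega$. **Finsler-Lyapunov function.** A $C^1$ function $V_\xi:T\Omega_\xi\to\mathbb{R}_+$ is a Finsler-Lyapunov function if there exist constants $d_1,d_2>0$, $d_3>1$ and a function $F_\xi:T\Omega_\xi\to\mathbb{R}_+$ with $d_1F_\xi(\xi,\delta\xi)^{d_3}\le V_\xi(\xi,\delta\xi)\le d_2F_\xi(\xi,\delta\xi)^{d_3}$ for all $(\xi,\delta\xi)\in T\Omega_\xi$, such that: (i) $F_\xi$ is $C^1$ for all $\xi\in\Omega_\xi$ and $\delta\xi\ne0$; (ii) $F_\xi(\xi,\delta\xi)\ge0$, with equality only when $\delta\xi=0$; (iii) $F_\xi(\xi,s\,\delta\xi)=|s|F_\xi(\xi,\delta\xi)$ for all $s\in\mathbb{R}$; (iv) $F_\xi(\xi,\delta\xi^1+\delta\xi^2)\le F_\xi(\xi,\delta\xi^1)+F_\xi(\xi,\delta\xi^2)$, with equality only when $\delta\xi^1,\delta\xi^2$ are linearly dependent; (v) there exist $d_4,d_5>0$ and a vector norm $|\cdot|$ with $d_4|\delta\xi|\le F_\xi(\xi,\delta\xi)\le d_5|\delta\xi|$ for all $(\xi,\delta\xi)\in T\Omega_\xi$. *)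

theory Defs
  imports "HOL-Analysis.Analysis"
begin

(* S need not be open: derivatives are taken within S, so on a state space with boundary
   this means C^1 up to the boundary. *)
definition C1_on :: "'a::real_normed_vector set \<Rightarrow> ('a \<Rightarrow> 'b::real_normed_vector) \<Rightarrow> bool" where
  "C1_on S f \<longleftrightarrow>
     (\<exists>f' :: 'a \<Rightarrow> 'a \<Rightarrow>\<^sub>L 'b.
        (\<forall>x\<in>S. (f has_derivative blinfun_apply (f' x)) (at x within S)) \<and> continuous_on S f')"

(* A vector norm other than the Euclidean one that the type carries. *)
definition vector_norm :: "('a::real_vector \<Rightarrow> real) \<Rightarrow> bool" where
  "vector_norm N \<longleftrightarrow>
     (\<forall>x. 0 \<le> N x) \<and> (\<forall>x. N x = 0 \<longleftrightarrow> x = 0) \<and>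
     (\<forall>s x. N (s *\<^sub>R x) = \<bar>s\<bar> * N x) \<and> (\<forall>x y. N (x + y) \<le> N x + N y)"

(* An n-dimensional C^1 submanifold of R^n, possibly with boundary and corners: K = {} is a chart at
   an interior point, K = {k} one at a boundary point. (A boundaryless closed nonempty one would
   be R^n itself.) *)
definition full_dim_manifold :: "(real^'n) set \<Rightarrow> bool" where
  "full_dim_manifold S \<longleftrightarrow>
     (\<forall>x\<in>S. \<exists>U W (\<phi> :: real^'n \<Rightarrow> real^'n) \<psi> (K :: 'n set).
        open U \<and> x \<in> U \<and> open W \<and> homeomorphism U W \<phi> \<psi> \<and> C1_on U \<phi> \<and> C1_on W \<psi> \<and>
        \<phi> ` (U \<inter> S) = W \<inter> {y. \<forall>k\<in>K. 0 \<le> y $ k})"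

(* In codimension zero every tangent space, also at a boundary point, is the whole ambient space. *)
definition tangent_bundle :: "(real^'n) set \<Rightarrow> ((real^'n) \<times> (real^'n)) set" where
  "tangent_bundle S = S \<times> UNIV"


(* Time is real; every statement about f and its solutions is restricted to t \<ge> 0. *)
definition solves :: "(real \<Rightarrow> real^'n \<Rightarrow> real^'n) \<Rightarrow> (real \<Rightarrow> real^'n) \<Rightarrow> bool" where
  "solves f y \<longleftrightarrow> (\<forall>t\<ge>0. (y has_vector_derivative f t (y t)) (at t within {0..}))"

(* X t a is the solution at time t that starts in a. *)
definition solution_map ::
  "(real^'n) set \<Rightarrow> (real \<Rightarrow> real^'n \<Rightarrow> real^'n) \<Rightarrow> (real \<Rightarrow> real^'n \<Rightarrow> real^'n) \<Rightarrow> bool" where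
  "solution_map \<Omega> f X \<longleftrightarrow>
     (\<forall>a\<in>\<Omega>. X 0 a = a \<and> solves f (\<lambda>t. X t a) \<and> (\<forall>t\<ge>0. X t a \<in> \<Omega>) \<and>
        (\<forall>y. solves f y \<and> y 0 = a \<longrightarrow> (\<forall>t\<ge>0. y t = X t a)))"

definition Jac :: "(real \<Rightarrow> real^'n \<Rightarrow> real^'n) \<Rightarrow> real \<Rightarrow> real^'n \<Rightarrow> real^'n^'n" where
  "Jac f t x = jacobian (f t) (at x)"


(* The fields h are indexed by a type 'l with l elements. There are n - l fields q, which may be
   none at all, so these are indexed by natural numbers below CARD('n) - CARD('l). *)
definition horizontal_space :: "('l::finite \<Rightarrow> real^'n \<Rightarrow> real^'n) \<Rightarrow> real^'n \<Rightarrow> (real^'n) set" where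
  "horizontal_space h x = span (range (\<lambda>j. h j x))"

definition vertical_space :: "nat \<Rightarrow> (nat \<Rightarrow> real^'n \<Rightarrow> real^'n) \<Rightarrow> real^'n \<Rightarrow> (real^'n) set" where
  "vertical_space m q x = span ((\<lambda>i. q i x) ` {..<m})"

definition Hmat :: "('l::finite \<Rightarrow> real^'n \<Rightarrow> real^'n) \<Rightarrow> real^'n \<Rightarrow> real^'l^'n" where
  "Hmat h x = (\<chi> i j. h j x $ i)"

definition Hf_mat ::
  "('l::finite \<Rightarrow> real^'n \<Rightarrow> real^'n) \<Rightarrow> (real \<Rightarrow> real^'n \<Rightarrow> real^'n) \<Rightarrow> real \<Rightarrow> real^'n \<Rightarrow> real^'l^'n" where
  "Hf_mat h f t x = (\<chi> i j. (jacobian (h j) (at x) *v f t x) $ i)"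

(* The l + (n - l) fields span R^n, hence they are linearly independent at each point, which makes
   the coordinates of a tangent vector unique. *)
definition horizontal_vertical ::
  "(real^'n) set \<Rightarrow> ('l::finite \<Rightarrow> real^'n \<Rightarrow> real^'n) \<Rightarrow> (nat \<Rightarrow> real^'n \<Rightarrow> real^'n) \<Rightarrow> bool" where
  "horizontal_vertical \<Omega> h q \<longleftrightarrow>
     (let m = CARD('n) - CARD('l) in
        (\<forall>j. C1_on UNIV (h j)) \<and> (\<forall>i<m. C1_on UNIV (q i)) \<and>
        (\<forall>(x, v)\<in>tangent_bundle \<Omega>. \<exists>u\<in>horizontal_space h x. \<exists>w\<in>vertical_space m q x. v = u + w) \<and>
        (\<forall>x\<in>\<Omega>. \<forall>u\<in>horizontal_space h x. \<forall>w\<in>vertical_space m q x. u \<bullet> w = 0) \<and>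
        bounded (Hmat h ` \<Omega>) \<and> (\<forall>i<m. bounded (q i ` \<Omega>)))"

(* dx is an arbitrary solution of the variational system along X t a, and u, w are its horizontal and
   vertical coordinates. *)
definition horizontally_contractive ::
  "(real^'n) set \<Rightarrow> (real \<Rightarrow> real^'n \<Rightarrow> real^'n) \<Rightarrow> (real \<Rightarrow> real^'n \<Rightarrow> real^'n) \<Rightarrow>
   ('l::finite \<Rightarrow> real^'n \<Rightarrow> real^'n) \<Rightarrow> (nat \<Rightarrow> real^'n \<Rightarrow> real^'n) \<Rightarrow> bool" where
  "horizontally_contractive \<Omega> f X h q \<longleftrightarrow>
     (\<exists>c \<eta> (N :: real^'l \<Rightarrow> real). c \<ge> 1 \<and> \<eta> > 0 \<and> vector_norm N \<and>
        (\<forall>a\<in>\<Omega>. \<forall>dx (u :: real \<Rightarrow> real^'l) (w :: real \<Rightarrow> nat \<Rightarrow> real).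
           solves (\<lambda>t v. Jac f t (X t a) *v v) dx \<longrightarrow>
           (\<forall>t\<ge>0. dx t = Hmat h (X t a) *v u t
                         + (\<Sum>i<CARD('n) - CARD('l). w t i *\<^sub>R q i (X t a))) \<longrightarrow>
           (\<forall>t\<ge>0. N (u t) \<le> c * exp (- \<eta> * t) * N (u 0))))"


definition f_aux ::
  "(real^'n \<Rightarrow> real^'l) \<Rightarrow> (real \<Rightarrow> real^'l \<Rightarrow> real^'n \<Rightarrow> real^'n) \<Rightarrow> real \<Rightarrow> real^'l \<Rightarrow> real^'n \<Rightarrow> real^'l" where
  "f_aux p g t \<xi> x = jacobian p (at x) *v g t \<xi> x"

definition J_aux ::
  "(real^'n \<Rightarrow> real^'l) \<Rightarrow> (real \<Rightarrow> real^'l \<Rightarrow> real^'n \<Rightarrow> real^'n) \<Rightarrow> real \<Rightarrow> real^'l \<Rightarrow> real^'n \<Rightarrow> real^'l^'l" where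
  "J_aux p g t \<xi> x = jacobian (\<lambda>\<xi>'. f_aux p g t \<xi>' x) (at \<xi>)"


(* Linear dependence of the pair (u, v); the library's dependent {u, v} fails for u = v. *)
definition pair_dependent :: "'a::real_vector \<Rightarrow> 'a \<Rightarrow> bool" where
  "pair_dependent u v \<longleftrightarrow> (\<exists>r s. (r \<noteq> 0 \<or> s \<noteq> 0) \<and> r *\<^sub>R u + s *\<^sub>R v = 0)"

definition finsler_lyapunov :: "(real^'l) set \<Rightarrow> ((real^'l) \<times> (real^'l) \<Rightarrow> real) \<Rightarrow> bool" where
  "finsler_lyapunov S V \<longleftrightarrow>
     C1_on (tangent_bundle S) V \<and> (\<forall>z\<in>tangent_bundle S. 0 \<le> V z) \<and>
     (\<exists>d1 d2 d3 (F :: (real^'l) \<times> (real^'l) \<Rightarrow> real).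
        d1 > 0 \<and> d2 > 0 \<and> d3 > 1 \<and>
        (\<forall>z\<in>tangent_bundle S. d1 * F z powr d3 \<le> V z \<and> V z \<le> d2 * F z powr d3) \<and>
        C1_on {(\<xi>, v) \<in> tangent_bundle S. v \<noteq> 0} F \<and>
        (\<forall>(\<xi>, v)\<in>tangent_bundle S. 0 \<le> F (\<xi>, v) \<and> (F (\<xi>, v) = 0 \<longrightarrow> v = 0)) \<and>
        (\<forall>(\<xi>, v)\<in>tangent_bundle S. \<forall>s. F (\<xi>, s *\<^sub>R v) = \<bar>s\<bar> * F (\<xi>, v)) \<and>
        (\<forall>\<xi> v1 v2. (\<xi>, v1) \<in> tangent_bundle S \<and> (\<xi>, v2) \<in> tangent_bundle S \<longrightarrow>
           F (\<xi>, v1 + v2) \<le> F (\<xi>, v1) + F (\<xi>, v2) \<and>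
           (F (\<xi>, v1 + v2) = F (\<xi>, v1) + F (\<xi>, v2) \<longrightarrow> pair_dependent v1 v2)) \<and>
        (\<exists>d4 d5 (N :: real^'l \<Rightarrow> real). d4 > 0 \<and> d5 > 0 \<and> vector_norm N \<and>
           (\<forall>(\<xi>, v)\<in>tangent_bundle S. d4 * N v \<le> F (\<xi>, v) \<and> F (\<xi>, v) \<le> d5 * N v)))"

(* The partial differentials of V as the two components of its total derivative, applied to a
   direction d. The derivative within the tangent bundle is unique when S is full-dimensional. *)
definition dV_xi :: "(real^'l) set \<Rightarrow> ((real^'l) \<times> (real^'l) \<Rightarrow> real) \<Rightarrow> real^'l \<Rightarrow> real^'l \<Rightarrow> real^'l \<Rightarrow> real" where
  "dV_xi S V \<xi> v d = frechet_derivative V (at (\<xi>, v) within tangent_bundle S) (d, 0)"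

definition dV_dxi :: "(real^'l) set \<Rightarrow> ((real^'l) \<times> (real^'l) \<Rightarrow> real) \<Rightarrow> real^'l \<Rightarrow> real^'l \<Rightarrow> real^'l \<Rightarrow> real" where
  "dV_dxi S V \<xi> v d = frechet_derivative V (at (\<xi>, v) within tangent_bundle S) (0, d)"

end

theory Submission
  imports Defs
begin

text \<open>
  The matrix \<open>H(x)\<^sup>T\<close> carries variations of the given system to variations of the auxiliary one. Along
  a solution \<open>x(t)\<close> put \<open>\<xi> = p(x)\<close>; since \<open>g(t, p(x), x) = f(t, x)\<close>, the curve \<open>\<xi>\<close> solves the
  auxiliary system. If \<open>\<delta>x\<close> solves the variational system along \<open>x\<close>, then \<open>y = H(x)\<^sup>T \<delta>x\<close> has
  derivative \<open>(H\<^sub>f\<^sup>T + H\<^sup>T J) \<delta>x\<close>, which by the compatibility condition equals \<open>J\<^sub>\<xi> y\<close>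
  (\<open>transported_variation_derivative\<close>). So \<open>(\<xi>, y)\<close> is a solution of the auxiliary system together
  with its variational system.

  The Finsler-Lyapunov function, evaluated along \<open>(\<xi>, y)\<close>, therefore decays like \<open>exp (- \<lambda> t)\<close>.
  As it is comparable with the power \<open>d\<^sub>3\<close> of a norm, \<open>y\<close> itself decays with rate \<open>\<lambda> / d\<^sub>3\<close>
  (\<open>finsler_lyapunov_exponential_decay\<close>).

  Finally, \<open>H\<^sup>T Q = 0\<close> removes the vertical coordinates from \<open>y\<close> and leaves \<open>y = H\<^sup>T H \<delta>x\<^sub>h\<close>
  (\<open>transported_variation_horizontal\<close>). The two-sided bound on \<open>H\<^sup>T H\<close>, uniform over the state space,
  turns the decay of \<open>y\<close> into that of \<open>\<delta>x\<^sub>h\<close>; the norm of the Finsler structure and the norm of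
  this bound are exchanged by equivalence of norms in finite dimension.
\<close>

section \<open>Equivalence of vector norms\<close>

text \<open>
  The upper bound comes from expanding in the standard basis. It makes the norm Lipschitz continuous,
  so on the compact Euclidean unit sphere the norm attains a minimum, which is positive; by
  homogeneity this minimum is the lower constant.
\<close>
lemma vector_norm_equivalent_euclidean:
  fixes N :: "'a::euclidean_space \<Rightarrow> real"
  assumes N: "vector_norm N"
  obtains a b where "a > 0" "b > 0" "\<And>x. a * norm x \<le> N x" "\<And>x. N x \<le> b * norm x"
proof -
  have N0: "0 \<le> N x" and Nz: "N x = 0 \<longleftrightarrow> x = 0" and Nh: "N (s *\<^sub>R x) = \<bar>s\<bar> * N x"
    and Nt: "N (x + y) \<le> N x + N y" for x y s
    using N unfolding vector_norm_def by blast+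
  have Nsum: "N (sum F A) \<le> (\<Sum>i\<in>A. N (F i))" if "finite A" for F :: "'a \<Rightarrow> 'a" and A
    using that
  proof (induction A rule: finite_induct)
    case empty
    then show ?case using Nz[of 0] by simp
  next
    case (insert i A)
    then show ?case using Nt[of "F i" "sum F A"] by simp
  qed
  define b where "b = (\<Sum>i\<in>Basis. N (i :: 'a)) + 1"
  have b: "b > 0" unfolding b_def using sum_nonneg[of Basis N] N0 by force
  have upper: "N x \<le> b * norm x" for x
  proof -
    have "N x = N (\<Sum>i\<in>Basis. (x \<bullet> i) *\<^sub>R i)" by (simp add: euclidean_representation)
    also have "\<dots> \<le> (\<Sum>i\<in>Basis. \<bar>x \<bullet> i\<bar> * N i)"
      using Nsum[of Basis "\<lambda>i. (x \<bullet> i) *\<^sub>R i"] by (simp add: Nh)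
    also have "\<dots> \<le> (\<Sum>i\<in>Basis. norm x * N i)"
      by (intro sum_mono mult_right_mono Basis_le_norm N0)
    also have "\<dots> = (b - 1) * norm x" by (simp add: b_def sum_distrib_left mult.commute)
    also have "\<dots> \<le> b * norm x" by (simp add: algebra_simps)
    finally show ?thesis .
  qed
  have lipschitz: "\<bar>N x - N y\<bar> \<le> b * norm (x - y)" for x y
  proof -
    have "N x \<le> N y + N (x - y)" "N y \<le> N x + N (y - x)"
      using Nt[of y "x - y"] Nt[of x "y - x"] by simp_all
    then show ?thesis
      using upper[of "x - y"] upper[of "y - x"] by (simp add: norm_minus_commute)
  qed
  have "b-lipschitz_on UNIV N"
    using lipschitz b by (intro lipschitz_onI) (auto simp: dist_norm)
  then have "continuous_on UNIV N" by (rule lipschitz_on_continuous_on)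
  then have cont: "continuous_on (sphere 0 1) N" by (rule continuous_on_subset) simp
  have "sphere (0::'a) 1 \<noteq> {}" by (simp add: sphere_eq_empty)
  with cont obtain z :: 'a where z: "norm z = 1" "\<And>y. norm y = 1 \<Longrightarrow> N z \<le> N y"
    using continuous_attains_inf[OF compact_sphere, of 0 1 N] by (auto simp: dist_norm)
  have "N z > 0" using N0[of z] Nz[of z] z(1) by force
  moreover have "N z * norm x \<le> N x" for x
  proof (cases "x = 0")
    case True
    then show ?thesis using N0 by simp
  next
    case False
    then have "N z \<le> N ((1 / norm x) *\<^sub>R x)" by (intro z(2)) simp
    also have "\<dots> = N x / norm x" by (simp add: Nh)
    finally show ?thesis using False by (simp add: field_simps)
  qed
  ultimately show thesis using that b upper by blast
qed

lemma vector_norms_comparable: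
  fixes N M :: "'a::euclidean_space \<Rightarrow> real"
  assumes "vector_norm N" "vector_norm M"
  obtains K where "K > 0" "\<And>x. N x \<le> K * M x"
proof -
  obtain b where b: "b > 0" "\<And>x. N x \<le> b * norm x"
    using vector_norm_equivalent_euclidean[OF assms(1)] by metis
  obtain a where a: "a > 0" "\<And>x. a * norm x \<le> M x"
    using vector_norm_equivalent_euclidean[OF assms(2)] by metis
  have "N x \<le> b / a * M x" for x
  proof -
    have "norm x \<le> M x / a" using a by (simp add: field_simps)
    then have "b * norm x \<le> b * (M x / a)" using b(1) by (intro mult_left_mono) auto
    then show ?thesis using b(2)[of x] by simp
  qed
  then show thesis using that[of "b / a"] a b by simp
qed

section \<open>Exponential decay from a Finsler-Lyapunov function\<close>

text \<open>
  A Gronwall estimate: the hypothesis says that \<open>exp (lam * t) * W t\<close> has nonpositive derivative.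
\<close>
lemma exponential_decay_differential_inequality:
  fixes W W' :: "real \<Rightarrow> real"
  assumes W: "\<And>t. t \<ge> 0 \<Longrightarrow> (W has_vector_derivative W' t) (at t within {0..})"
    and W': "\<And>t. t \<ge> 0 \<Longrightarrow> W' t \<le> - lam * W t"
    and t: "t \<ge> 0"
  shows "W t \<le> exp (- lam * t) * W 0"
proof -
  define E where "E s = exp (lam * s) * W s" for s
  have E: "(E has_field_derivative exp (lam * s) * (lam * W s + W' s)) (at s within {0..})"
    if "s \<ge> 0" for s
    unfolding E_def using W[OF that, unfolded has_real_derivative_iff_has_vector_derivative[symmetric]]
    by (auto intro!: derivative_eq_intros simp: algebra_simps)
  have "E t \<le> E 0"
  proof (rule DERIV_nonpos_imp_decreasing_open[OF t])
    fix s :: real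
    assume s: "0 < s" "s < t"
    have "at s within {0..} = at s" using s by (intro at_within_interior) simp
    then have "(E has_field_derivative exp (lam * s) * (lam * W s + W' s)) (at s)"
      using E[of s] s by simp
    moreover have "exp (lam * s) * (lam * W s + W' s) \<le> 0"
      using W'[of s] s by (intro mult_nonneg_nonpos) auto
    ultimately show "\<exists>y. (E has_field_derivative y) (at s) \<and> y \<le> 0" by blast
  next
    have "continuous_on {0..} E"
      by (rule DERIV_continuous_on[of _ E "\<lambda>s. exp (lam * s) * (lam * W s + W' s)"]) (auto intro: E)
    then show "continuous_on {0..t} E" by (rule continuous_on_subset) auto
  qed
  then have "exp (- lam * t) * E t \<le> exp (- lam * t) * W 0" by (simp add: E_def)
  then show ?thesis by (simp add: E_def mult.assoc[symmetric] exp_add[symmetric])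
qed

text \<open>
  The two partial differentials add up to one total differential applied to \<open>(\<xi>', v')\<close>, so the decay
  condition is exactly a bound on the derivative of \<open>V\<close> along a curve in the tangent bundle. The
  constants are chosen before the curve: horizontal contraction needs them uniform over all
  solutions.
\<close>
lemma finsler_lyapunov_exponential_decay:
  fixes V :: "(real^'l) \<times> (real^'l) \<Rightarrow> real"
  assumes V: "finsler_lyapunov S V" and lam: "lam > 0"
  obtains C \<eta> M where "C > 0" "\<eta> > 0" "vector_norm M"
    "\<And>\<xi> \<xi>' v v' t.
       (\<And>s. s \<ge> 0 \<Longrightarrow> \<xi> s \<in> S) \<Longrightarrow>
       (\<And>s. s \<ge> 0 \<Longrightarrow> (\<xi> has_vector_derivative \<xi>' s) (at s within {0..})) \<Longrightarrow>
       (\<And>s. s \<ge> 0 \<Longrightarrow> (v has_vector_derivative v' s) (at s within {0..})) \<Longrightarrow>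
       (\<And>s. s \<ge> 0 \<Longrightarrow> dV_xi S V (\<xi> s) (v s) (\<xi>' s) + dV_dxi S V (\<xi> s) (v s) (v' s)
                        \<le> - lam * V (\<xi> s, v s)) \<Longrightarrow>
       t \<ge> 0 \<Longrightarrow> M (v t) \<le> C * exp (- \<eta> * t) * M (v 0)"
proof -
  obtain d1 d2 d3 d4 d5 :: real and F :: "(real^'l) \<times> (real^'l) \<Rightarrow> real" and M :: "real^'l \<Rightarrow> real"
    where VF_ball: "\<forall>z\<in>tangent_bundle S. d1 * F z powr d3 \<le> V z \<and> V z \<le> d2 * F z powr d3"
    and F0_ball: "\<forall>(\<xi>, v)\<in>tangent_bundle S. 0 \<le> F (\<xi>, v) \<and> (F (\<xi>, v) = 0 \<longrightarrow> v = 0)"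
    and FM_ball: "\<forall>(\<xi>, v)\<in>tangent_bundle S. d4 * M v \<le> F (\<xi>, v) \<and> F (\<xi>, v) \<le> d5 * M v"
    and M: "vector_norm M" and d: "d1 > 0" "d2 > 0" "d3 > 1" "d4 > 0" "d5 > 0"
    using V unfolding finsler_lyapunov_def by (elim conjE exE) (rule that, assumption+)
  note VF = bspec[OF VF_ball]
  have F0: "0 \<le> F (\<xi>, v)" and FM: "d4 * M v \<le> F (\<xi>, v) \<and> F (\<xi>, v) \<le> d5 * M v"
    if "(\<xi>, v) \<in> tangent_bundle S" for \<xi> v
    using bspec[OF F0_ball that] bspec[OF FM_ball that] by simp_all
  have V_diff: "V differentiable (at z within tangent_bundle S)" if "z \<in> tangent_bundle S" for z
    using V that unfolding finsler_lyapunov_def C1_on_def differentiable_def by blast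
  \<comment> \<open>Passing from \<open>M\<close> to \<open>F\<close> and back costs \<open>d5 / d4\<close>, and passing from \<open>F powr d3\<close> to \<open>V\<close> and
     back costs \<open>d2 / d1\<close>, of which the root of order \<open>d3\<close> remains.\<close>
  define C where "C = d5 / d4 * (d2 / d1) powr (1 / d3)"
  have C: "C > 0" using d by (simp add: C_def)
  have decay: "M (v t) \<le> C * exp (- (lam / d3) * t) * M (v 0)"
    if \<xi>_in: "\<And>s. s \<ge> 0 \<Longrightarrow> \<xi> s \<in> S"
      and \<xi>: "\<And>s. s \<ge> 0 \<Longrightarrow> (\<xi> has_vector_derivative \<xi>' s) (at s within {0..})"
      and v: "\<And>s. s \<ge> 0 \<Longrightarrow> (v has_vector_derivative v' s) (at s within {0..})"
      and dec: "\<And>s. s \<ge> 0 \<Longrightarrow> dV_xi S V (\<xi> s) (v s) (\<xi>' s) + dV_dxi S V (\<xi> s) (v s) (v' s)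
                               \<le> - lam * V (\<xi> s, v s)"
      and t: "t \<ge> 0" for \<xi> \<xi>' v v' t
  proof -
    have in_TS: "(\<xi> s, v s) \<in> tangent_bundle S" if "s \<ge> 0" for s
      using \<xi>_in[OF that] by (simp add: tangent_bundle_def)
    define D where "D s = frechet_derivative V (at (\<xi> s, v s) within tangent_bundle S)" for s
    have W: "((\<lambda>s. V (\<xi> s, v s)) has_vector_derivative D s (\<xi>' s, v' s)) (at s within {0..})"
      if s: "s \<ge> 0" for s
    proof -
      have z: "((\<lambda>s. (\<xi> s, v s)) has_vector_derivative (\<xi>' s, v' s)) (at s within {0..})"
        by (intro has_vector_derivative_Pair \<xi> v s)
      have "(V has_derivative D s) (at (\<xi> s, v s) within tangent_bundle S)"
        using V_diff[OF in_TS[OF s]] unfolding D_def by (simp add: frechet_derivative_works)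
      then have "(V has_derivative D s) (at (\<xi> s, v s) within (\<lambda>s. (\<xi> s, v s)) ` {0..})"
        by (rule has_derivative_subset) (use in_TS in auto)
      with z show ?thesis
        using vector_derivative_diff_chain_within[of "\<lambda>s. (\<xi> s, v s)" "(\<xi>' s, v' s)" s "{0..}" V "D s"]
        by (simp add: o_def)
    qed
    have "D s (\<xi>' s, v' s) \<le> - lam * V (\<xi> s, v s)" if s: "s \<ge> 0" for s
    proof -
      \<comment> \<open>Both partial differentials come from the same chosen derivative of \<open>V\<close>, so linearity joins them.\<close>
      have "linear (D s)"
        using V_diff[OF in_TS[OF s]] unfolding D_def by (rule linear_frechet_derivative)
      from linear_add[OF this, of "(\<xi>' s, 0)" "(0, v' s)"]
      have "D s (\<xi>' s, v' s) = D s (\<xi>' s, 0) + D s (0, v' s)" by simp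
      then show ?thesis using dec[OF s] by (simp add: D_def dV_xi_def dV_dxi_def)
    qed
    from exponential_decay_differential_inequality[OF W this t]
    have Vt: "V (\<xi> t, v t) \<le> exp (- lam * t) * V (\<xi> 0, v 0)" by simp
    let ?F = "\<lambda>s. F (\<xi> s, v s)"
    have F_nonneg: "0 \<le> ?F t" "0 \<le> ?F 0" using F0 in_TS t by auto
    have "d1 * ?F t powr d3 \<le> V (\<xi> t, v t)" using VF in_TS t by blast
    also note Vt
    also have "exp (- lam * t) * V (\<xi> 0, v 0) \<le> exp (- lam * t) * (d2 * ?F 0 powr d3)"
      using VF[OF in_TS[OF order_refl]] by (intro mult_left_mono) auto
    finally have "?F t powr d3 \<le> (d2 / d1) * (exp (- lam * t) * ?F 0 powr d3)"
      using d by (simp add: field_simps)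
    then have "(?F t powr d3) powr (1 / d3)
        \<le> ((d2 / d1) * (exp (- lam * t) * ?F 0 powr d3)) powr (1 / d3)"
      using d by (intro powr_mono2) auto
    also have "\<dots> = (d2 / d1) powr (1 / d3) * (exp (- lam * t) powr (1 / d3) * (?F 0 powr d3) powr (1 / d3))"
      by (simp only: powr_mult)
    also have "exp (- lam * t) powr (1 / d3) = exp (- (lam / d3) * t)"
      by (simp add: powr_def)
    also have "(?F 0 powr d3) powr (1 / d3) = ?F 0"
      using d F_nonneg by (simp add: powr_powr)
    also have "(?F t powr d3) powr (1 / d3) = ?F t"
      using d F_nonneg by (simp add: powr_powr)
    finally have Ft: "?F t \<le> (d2 / d1) powr (1 / d3) * (exp (- (lam / d3) * t) * ?F 0)" .
    have "d4 * M (v t) \<le> ?F t" using FM in_TS t by blast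
    also note Ft
    also have "(d2 / d1) powr (1 / d3) * (exp (- (lam / d3) * t) * ?F 0)
        \<le> (d2 / d1) powr (1 / d3) * (exp (- (lam / d3) * t) * (d5 * M (v 0)))"
      using FM[OF in_TS[OF order_refl]] by (intro mult_left_mono) auto
    finally show ?thesis using d by (simp add: C_def field_simps)
  qed
  show thesis
    by (rule that[of C "lam / d3" M, OF C _ M]) (use d lam in simp, fact decay)
qed

section \<open>The variation carried to the auxiliary system\<close>

lemma transpose_Hmat_component: "(transpose (Hmat h x) *v y) $ j = h j x \<bullet> y"
  by (simp add: matrix_vector_mult_def transpose_def Hmat_def inner_vec_def)

lemma transpose_Hf_mat_component:
  "(transpose (Hf_mat h f t x) *v y) $ j = (jacobian (h j) (at x) *v f t x) \<bullet> y"
  by (simp add: matrix_vector_mult_def transpose_def Hf_mat_def inner_vec_def)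

text \<open>Componentwise, this is the product rule for \<open>h j x \<bullet> \<delta>x\<close>.\<close>
lemma transported_variation_derivative:
  fixes h :: "'l::finite \<Rightarrow> real^'n \<Rightarrow> real^'n"
  assumes h: "\<And>j. h j differentiable (at (x t))"
    and x: "(x has_vector_derivative f t (x t)) (at t within T)"
    and dx: "(dx has_vector_derivative A *v dx t) (at t within T)"
  shows "((\<lambda>s. transpose (Hmat h (x s)) *v dx s) has_vector_derivative
            (transpose (Hf_mat h f t (x t)) + transpose (Hmat h (x t)) ** A) *v dx t) (at t within T)"
proof -
  have "((\<lambda>s. h j (x s) \<bullet> dx s) has_vector_derivative
            h j (x t) \<bullet> (A *v dx t) + (jacobian (h j) (at (x t)) *v f t (x t)) \<bullet> dx t) (at t within T)" for j
  proof -
    have "(h j has_derivative (*v) (jacobian (h j) (at (x t)))) (at (x t))"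
      using h by (simp add: jacobian_works)
    then have "(h j has_derivative (*v) (jacobian (h j) (at (x t)))) (at (x t) within x ` T)"
      by (rule has_derivative_at_withinI)
    from vector_derivative_diff_chain_within[OF x this]
    have "((\<lambda>s. h j (x s)) has_vector_derivative jacobian (h j) (at (x t)) *v f t (x t)) (at t within T)"
      by (simp add: o_def)
    from bounded_bilinear.has_vector_derivative[OF bounded_bilinear_inner this dx]
    show ?thesis .
  qed
  then have comp: "((\<lambda>s. (transpose (Hmat h (x s)) *v dx s) $ j) has_vector_derivative
      ((transpose (Hf_mat h f t (x t)) + transpose (Hmat h (x t)) ** A) *v dx t) $ j) (at t within T)" for j
    by (simp add: transpose_Hmat_component transpose_Hf_mat_component matrix_vector_mult_add_rdistrib
        matrix_vector_mul_assoc[symmetric] add.commute del: transpose_matrix_vector)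
  show ?thesis
    unfolding has_vector_derivative_def
  proof (subst has_derivative_componentwise_within, intro ballI)
    fix b :: "real^'l"
    assume "b \<in> Basis"
    then obtain j where b: "b = axis j 1" by (auto simp: Basis_vec_def)
    show "((\<lambda>s. (transpose (Hmat h (x s)) *v dx s) \<bullet> b) has_derivative
        (\<lambda>r. (r *\<^sub>R ((transpose (Hf_mat h f t (x t)) + transpose (Hmat h (x t)) ** A) *v dx t)) \<bullet> b))
        (at t within T)"
      using comp[of j] unfolding has_vector_derivative_def b by (simp add: inner_axis)
  qed
qed

lemma transported_variation_horizontal:
  fixes h :: "'l::finite \<Rightarrow> real^'n \<Rightarrow> real^'n"
  assumes "horizontal_vertical \<Omega> h q" and "x \<in> \<Omega>"
  shows "transpose (Hmat h x) *v (Hmat h x *v u + (\<Sum>i<CARD('n) - CARD('l). w i *\<^sub>R q i x))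
           = (transpose (Hmat h x) ** Hmat h x) *v u"
proof -
  have "h j x \<bullet> q i x = 0" if "i < CARD('n) - CARD('l)" for i j
  proof -
    have "h j x \<in> horizontal_space h x"
      unfolding horizontal_space_def by (intro span_base) auto
    moreover have "q i x \<in> vertical_space (CARD('n) - CARD('l)) q x"
      unfolding vertical_space_def by (intro span_base) (use that in auto)
    ultimately show ?thesis using assms unfolding horizontal_vertical_def Let_def by blast
  qed
  then have "transpose (Hmat h x) *v (\<Sum>i<CARD('n) - CARD('l). w i *\<^sub>R q i x) = 0"
    by (simp add: vec_eq_iff transpose_Hmat_component inner_sum_right del: transpose_matrix_vector)
  then show ?thesis
    by (simp add: matrix_vector_right_distrib matrix_vector_mul_assoc del: transpose_matrix_vector)
qed

section \<open>Horizontal contraction from partial contraction\<close>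

theorem theorem1:
  fixes \<Omega> :: "(real^'n) set"
    and f :: "real \<Rightarrow> real^'n \<Rightarrow> real^'n"
    and X :: "real \<Rightarrow> real^'n \<Rightarrow> real^'n"
    and h :: "'l::finite \<Rightarrow> real^'n \<Rightarrow> real^'n"
    and q :: "nat \<Rightarrow> real^'n \<Rightarrow> real^'n"
    and p :: "real^'n \<Rightarrow> real^'l"
    and g :: "real \<Rightarrow> real^'l \<Rightarrow> real^'n \<Rightarrow> real^'n"
    and \<Omega>_xi :: "(real^'l) set"
    and V :: "(real^'l) \<times> (real^'l) \<Rightarrow> real"
    and N :: "real^'l \<Rightarrow> real"
    and lam d6 d7 :: real
  assumes l_le_n: "CARD('l) \<le> CARD('n)"
    and \<Omega>: "closed \<Omega>" "connected \<Omega>" "full_dim_manifold \<Omega>"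
    and f_C1: "\<And>t. t \<ge> 0 \<Longrightarrow> C1_on UNIV (f t)"
    and flow: "solution_map \<Omega> f X"
    and \<Omega>_aux: "full_dim_manifold \<Omega>_xi"
    and p_range: "\<And>x. x \<in> \<Omega> \<Longrightarrow> p x \<in> \<Omega>_xi"
    and p_diff: "\<And>x. x \<in> \<Omega> \<Longrightarrow> p differentiable (at x)"
    and g_diff: "\<And>t x \<xi>. t \<ge> 0 \<Longrightarrow> x \<in> \<Omega> \<Longrightarrow> \<xi> \<in> \<Omega>_xi \<Longrightarrow> (\<lambda>\<xi>'. g t \<xi>' x) differentiable (at \<xi>)"
    and g_f: "\<And>t x. t \<ge> 0 \<Longrightarrow> x \<in> \<Omega> \<Longrightarrow> g t (p x) x = f t x"
    and lam_pos: "lam > 0"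
    and V: "finsler_lyapunov \<Omega>_xi V"
    and V_decay: "\<And>t x \<xi> v. t \<ge> 0 \<Longrightarrow> x \<in> \<Omega> \<Longrightarrow> (\<xi>, v) \<in> tangent_bundle \<Omega>_xi \<Longrightarrow>
        dV_xi \<Omega>_xi V \<xi> v (f_aux p g t \<xi> x) + dV_dxi \<Omega>_xi V \<xi> v (J_aux p g t \<xi> x *v v) \<le> - lam * V (\<xi>, v)"
    and distr: "horizontal_vertical \<Omega> h q"
    and N: "vector_norm N" "d6 > 0" "d7 > 0"
    and H_bounds: "\<And>x y. x \<in> \<Omega> \<Longrightarrow>
        d6 * N y \<le> N ((transpose (Hmat h x) ** Hmat h x) *v y) \<and>
        N ((transpose (Hmat h x) ** Hmat h x) *v y) \<le> d7 * N y"
    and compat: "\<And>t x. t \<ge> 0 \<Longrightarrow> x \<in> \<Omega> \<Longrightarrow>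
        transpose (Hf_mat h f t x) + transpose (Hmat h x) ** Jac f t x
          = J_aux p g t (p x) x ** transpose (Hmat h x)"
  shows "horizontally_contractive \<Omega> f X h q"
proof -
  obtain C \<eta> M where C: "C > 0" "\<eta> > 0" and M: "vector_norm M"
    and decay: "\<And>\<xi> \<xi>' v v' t.
       (\<And>s. s \<ge> 0 \<Longrightarrow> \<xi> s \<in> \<Omega>_xi) \<Longrightarrow>
       (\<And>s. s \<ge> 0 \<Longrightarrow> (\<xi> has_vector_derivative \<xi>' s) (at s within {0..})) \<Longrightarrow>
       (\<And>s. s \<ge> 0 \<Longrightarrow> (v has_vector_derivative v' s) (at s within {0..})) \<Longrightarrow>
       (\<And>s. s \<ge> 0 \<Longrightarrow> dV_xi \<Omega>_xi V (\<xi> s) (v s) (\<xi>' s) + dV_dxi \<Omega>_xi V (\<xi> s) (v s) (v' s)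
                        \<le> - lam * V (\<xi> s, v s)) \<Longrightarrow>
       t \<ge> 0 \<Longrightarrow> M (v t) \<le> C * exp (- \<eta> * t) * M (v 0)"
    using finsler_lyapunov_exponential_decay[OF V lam_pos] by blast
  obtain K where K: "K > 0" "\<And>y. N y \<le> K * M y"
    using vector_norms_comparable[OF N(1) M] by blast
  obtain L where L: "L > 0" "\<And>y. M y \<le> L * N y"
    using vector_norms_comparable[OF M N(1)] by blast
  have N0: "0 \<le> N y" for y using N(1) by (simp add: vector_norm_def)
  \<comment> \<open>The factors collect the chain from \<open>N (u t)\<close> through \<open>N (y t)\<close>, \<open>M (y t)\<close>, \<open>M (y 0)\<close> and
     \<open>N (y 0)\<close> to \<open>N (u 0)\<close>; the maximum ensures \<open>c \<ge> 1\<close>.\<close>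
  define c where "c = max 1 (K * C * L * d7 / d6)"
  have h_diff: "h j differentiable (at x)" for j x
    using distr unfolding horizontal_vertical_def Let_def C1_on_def differentiable_def by blast
  have main: "N (u t) \<le> c * exp (- \<eta> * t) * N (u 0)"
    if a: "a \<in> \<Omega>" and dx: "solves (\<lambda>t v. Jac f t (X t a) *v v) dx"
      and split: "\<forall>t\<ge>0. dx t = Hmat h (X t a) *v u t
                         + (\<Sum>i<CARD('n) - CARD('l). w t i *\<^sub>R q i (X t a))"
      and t: "t \<ge> 0" for a dx w t and u :: "real \<Rightarrow> real^'l"
  proof -
    define x where "x s = X s a" for s
    have "solves f x" "\<forall>t\<ge>0. x t \<in> \<Omega>"
      using bspec[OF flow[unfolded solution_map_def] a] by (simp_all add: x_def[abs_def])
    then have x_in: "x s \<in> \<Omega>" and x': "(x has_vector_derivative f s (x s)) (at s within {0..})"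
      if "s \<ge> 0" for s
      using that by (simp_all add: solves_def)
    define \<xi> where "\<xi> s = p (x s)" for s
    define y where "y s = transpose (Hmat h (x s)) *v dx s" for s
    have \<xi>': "(\<xi> has_vector_derivative f_aux p g s (\<xi> s) (x s)) (at s within {0..})" if s: "s \<ge> 0" for s
    proof -
      have "(p has_derivative (*v) (jacobian p (at (x s)))) (at (x s) within x ` {0..})"
        using p_diff[OF x_in[OF s]] by (simp add: jacobian_works has_derivative_at_withinI)
      from vector_derivative_diff_chain_within[OF x'[OF s] this]
      show ?thesis using g_f[OF s x_in[OF s]] by (simp add: o_def \<xi>_def[abs_def] f_aux_def)
    qed
    have y': "(y has_vector_derivative J_aux p g s (\<xi> s) (x s) *v y s) (at s within {0..})"
      if s: "s \<ge> 0" for s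
    proof -
      have "(dx has_vector_derivative Jac f s (x s) *v dx s) (at s within {0..})"
        using dx s by (simp add: solves_def x_def)
      from transported_variation_derivative[where h = h and x = x and t = s and f = f and dx = dx,
          OF h_diff x'[OF s] this]
      show ?thesis
        using compat[OF s x_in[OF s]]
        by (simp add: y_def[abs_def] \<xi>_def matrix_vector_mul_assoc del: transpose_matrix_vector)
    qed
    have My: "M (y t) \<le> C * exp (- \<eta> * t) * M (y 0)"
    proof (rule decay[OF _ \<xi>' y' _ t])
      show \<xi>_in: "\<xi> s \<in> \<Omega>_xi" if "s \<ge> 0" for s
        using p_range x_in that by (simp add: \<xi>_def)
      show "dV_xi \<Omega>_xi V (\<xi> s) (y s) (f_aux p g s (\<xi> s) (x s))
          + dV_dxi \<Omega>_xi V (\<xi> s) (y s) (J_aux p g s (\<xi> s) (x s) *v y s) \<le> - lam * V (\<xi> s, y s)"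
        if s: "s \<ge> 0" for s
        using V_decay[OF s x_in[OF s]] \<xi>_in[OF s] by (simp add: tangent_bundle_def)
    qed
    have y_u: "y s = (transpose (Hmat h (x s)) ** Hmat h (x s)) *v u s" if s: "s \<ge> 0" for s
      using transported_variation_horizontal[OF distr x_in[OF s], of "u s" "w s"] split s
      by (simp add: y_def x_def del: transpose_matrix_vector)
    have "d6 * N (u t) \<le> N (y t)"
      using H_bounds[OF x_in[OF t]] y_u[OF t] by simp
    also have "\<dots> \<le> K * M (y t)" by (rule K)
    also have "\<dots> \<le> K * (C * exp (- \<eta> * t) * M (y 0))"
      using My K by (intro mult_left_mono) auto
    also have "\<dots> \<le> K * (C * exp (- \<eta> * t) * (L * N (y 0)))"
      using L C K by (intro mult_left_mono) auto
    also have "\<dots> \<le> K * (C * exp (- \<eta> * t) * (L * (d7 * N (u 0))))"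
      using H_bounds[OF x_in[OF order_refl]] y_u[OF order_refl] L C K by (intro mult_left_mono) auto
    finally have "N (u t) \<le> (K * C * L * d7 / d6) * (exp (- \<eta> * t) * N (u 0))"
      using N by (simp add: field_simps)
    also have "\<dots> \<le> c * (exp (- \<eta> * t) * N (u 0))"
      using N0 by (intro mult_right_mono) (auto simp: c_def)
    finally show ?thesis by simp
  qed
  show ?thesis
    unfolding horizontally_contractive_def
    by (intro exI[of _ c] exI[of _ \<eta>] exI[of _ N] conjI ballI allI impI)
      (use C N main in \<open>auto simp: c_def\<close>)
qed

end
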